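(* Let $F$ be an infinite field, let $n \in \mathbb{N}$, and let $f \in F\langle X_1,\ldots,X_n\rangle$ be a nonzero multilinear polynomial. Then $\mathrm{sl}_\infty(F) \subseteq f(M_\infty(F))$.
   Context: $\mathbb{N}$ denotes the positive integers. $F\langle X_1,\ldots,X_n\rangle$ is the free associative unital $F$-algebra in $X_1,\ldots,X_n$. A polynomial $f \in F\langle X_1,\ldots,X_n\rangle$ is multilinear if it has the form $f = \sum_{\sigma \in S_n} \lambda_\sigma X_{\sigma(1)} \cdots X_{\sigma(n)}$ with $\lambda_\sigma \in F$. For an $F$-algebra $A$ (not necessarily unital), the image of such an $f$ in $A$ is $f(A) = \{f(a_1,\ldots,a_n) \mid a_1,\ldots,a_n \in A\}$. $M_\infty(F)$ denotes the $F$-algebra of all finitary matrices, i.e., countably infinite matrices (rows and columns indexed by $\mathbb{N}$) over $F$ with only finitely many nonzero entries, and $\mathrm{sl}_\infty(F)$ denotes the space of all matrices in $M_\infty(F)$ with trace zero. *)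

theory Defs
  imports Complex_Main "HOL-Library.Poly_Mapping" "HOL-Combinatorics.Permutations"
begin

section \<open>The free associative unital algebra\<close>

text \<open>
  Words are wrapped in a datatype so that the additive notation required by
  \<^theory>\<open>HOL-Library.Poly_Mapping\<close> can stand for concatenation: with that monoid, the product of
  poly mappings is the product of the free algebra. The variables are indexed by \<^typ>\<open>nat\<close>.
\<close>

datatype word = Word (letters: "nat list")

instantiation word :: monoid_add
begin

definition zero_word :: word where
  "zero_word = Word []"

definition plus_word :: "word \<Rightarrow> word \<Rightarrow> word" where
  "plus_word u v = Word (letters u @ letters v)"

instance
  by standard (simp_all add: zero_word_def plus_word_def)

end

type_synonym 'f nc_poly = "word \<Rightarrow>\<^sub>0 'f"

definition Var :: "nat \<Rightarrow> 'f::field nc_poly" where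
  "Var i = Poly_Mapping.single (Word [i]) 1"

definition Const :: "'f::field \<Rightarrow> 'f nc_poly" where
  "Const c = Poly_Mapping.single 0 c"

definition free_algebra :: "nat \<Rightarrow> 'f::field nc_poly set" where
  "free_algebra n = {f. \<forall>w \<in> Poly_Mapping.keys f. set (letters w) \<subseteq> {1..n}}"

definition multilinear :: "nat \<Rightarrow> 'f::field nc_poly \<Rightarrow> bool" where
  "multilinear n f \<longleftrightarrow>
     (\<exists>c. f = (\<Sum>\<sigma> | \<sigma> permutes {1..n}. Const (c \<sigma>) * (\<Prod>i\<leftarrow>[1..<Suc n]. Var (\<sigma> i))))"

lemma prod_list_Var: "(\<Prod>i\<leftarrow>is. Var (\<sigma> i)) = Poly_Mapping.single (Word (map \<sigma> is)) (1::'f::field)"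
  by (induction "is")
     (simp_all add: Var_def mult_single plus_word_def flip: zero_word_def)

lemma multilinear_altdef:
  "multilinear n f \<longleftrightarrow>
     (\<exists>c. f = (\<Sum>\<sigma> | \<sigma> permutes {1..n}. Poly_Mapping.single (Word (map \<sigma> [1..<Suc n])) (c \<sigma>)))"
  by (simp add: multilinear_def prod_list_Var Const_def mult_single del: upt_Suc)


section \<open>Evaluation in algebras that need not be unital\<close>

locale nonunital_algebra = vector_space scale
  for scale :: "'f::field \<Rightarrow> 'a::ring \<Rightarrow> 'a" +
  assumes scale_mult_left: "scale c (x * y) = scale c x * y"
    and scale_mult_right: "scale c (x * y) = x * scale c y"

text \<open>
  Without a unit the empty word has no value, so evaluation is meaningful only for polynomials with
  zero constant term; the value \<open>0\<close> for the empty word is a dummy. Multilinear polynomials in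
  \<open>n \<ge> 1\<close> variables have no constant term.
\<close>

fun word_eval :: "(nat \<Rightarrow> 'a::ring) \<Rightarrow> nat list \<Rightarrow> 'a" where
  "word_eval a [] = 0"
| "word_eval a [i] = a i"
| "word_eval a (i # j # w) = a i * word_eval a (j # w)"

lemma word_eval_append:
  "u \<noteq> [] \<Longrightarrow> v \<noteq> [] \<Longrightarrow> word_eval a (u @ v) = word_eval a u * word_eval a v"
  by (induction a u rule: word_eval.induct) (auto simp: neq_Nil_conv mult.assoc)

context nonunital_algebra
begin

definition poly_eval :: "(nat \<Rightarrow> 'a) \<Rightarrow> 'f nc_poly \<Rightarrow> 'a" where
  "poly_eval a f =
     (\<Sum>w\<in>Poly_Mapping.keys f. scale (Poly_Mapping.lookup f w) (word_eval a (letters w)))"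

text \<open>
  An assignment also gives values to variables not occurring in \<open>f\<close>; these do not affect
  \<^term>\<open>poly_eval a f\<close>, so for \<open>f\<close> in \<^term>\<open>free_algebra n\<close> this is the set of all
  \<open>f(a\<^sub>1, \<dots>, a\<^sub>n)\<close>.
\<close>

definition poly_image :: "'f nc_poly \<Rightarrow> 'a set" where
  "poly_image f = {poly_eval a f |a. True}"

lemma poly_eval_superset:
  assumes "finite S" "Poly_Mapping.keys f \<subseteq> S"
  shows "poly_eval a f = (\<Sum>w\<in>S. scale (Poly_Mapping.lookup f w) (word_eval a (letters w)))"
  unfolding poly_eval_def
  by (rule sum.mono_neutral_left) (use assms in \<open>auto simp: in_keys_iff\<close>)

lemma poly_eval_0 [simp]: "poly_eval a 0 = 0"
  by (simp add: poly_eval_def)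

lemma poly_eval_single [simp]: "poly_eval a (Poly_Mapping.single w c) = scale c (word_eval a (letters w))"
  by (simp add: poly_eval_def)

lemma poly_eval_add: "poly_eval a (f + g) = poly_eval a f + poly_eval a g"
proof -
  let ?S = "Poly_Mapping.keys f \<union> Poly_Mapping.keys g"
  have "Poly_Mapping.keys (f + g) \<subseteq> ?S"
    by (rule keys_add)
  then show ?thesis
    by (simp add: poly_eval_superset[where S = ?S] lookup_add scale_left_distrib sum.distrib)
qed

lemma poly_eval_sum: "poly_eval a (\<Sum>x\<in>I. f x) = (\<Sum>x\<in>I. poly_eval a (f x))"
  by (induction I rule: infinite_finite_induct) (simp_all add: poly_eval_add)

lemma poly_eval_cong:
  assumes "f \<in> free_algebra n" "\<And>i. i \<in> {1..n} \<Longrightarrow> a i = b i"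
  shows "poly_eval a f = poly_eval b f"
proof -
  have *: "word_eval a w = word_eval b w" if "set w \<subseteq> {1..n}" for w
    using that assms(2) by (induction a w rule: word_eval.induct) auto
  show ?thesis
    unfolding poly_eval_def
    by (rule sum.cong) (use assms(1) * in \<open>auto simp: free_algebra_def\<close>)
qed

end


section \<open>Finitary matrices\<close>

text \<open>Rows and columns are indexed by \<^typ>\<open>nat\<close>, so the first index is \<open>0\<close>.\<close>

typedef (overloaded) 'f finitary_matrix =
  "{A :: nat \<Rightarrow> nat \<Rightarrow> 'f::zero. finite {(i, j). A i j \<noteq> 0}}"
  morphisms entry Finitary_Matrix
  by (rule exI[of _ "\<lambda>_ _. 0"]) simp

setup_lifting type_definition_finitary_matrix

lemma finite_entry: "finite {(i, j). entry A i j \<noteq> 0}"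
  using entry[of A] by simp

lemma finitary_matrix_eqI: "(\<And>i j. entry A i j = entry B i j) \<Longrightarrow> A = B"
  by (metis entry_inject ext)

lemma finitary_bound:
  fixes A :: "nat \<Rightarrow> nat \<Rightarrow> 'f::zero"
  shows "finite {(i, j). A i j \<noteq> 0} \<longleftrightarrow> (\<exists>N. \<forall>i j. A i j \<noteq> 0 \<longrightarrow> i < N \<and> j < N)"
proof
  assume fin: "finite {(i, j). A i j \<noteq> 0}"
  let ?S = "fst ` {(i, j). A i j \<noteq> 0} \<union> snd ` {(i, j). A i j \<noteq> 0}"
  have "finite ?S" using fin by simp
  then obtain N where N: "\<forall>x\<in>?S. x < N"
    by (meson finite_nat_set_iff_bounded)
  have "i < N \<and> j < N" if "A i j \<noteq> 0" for i j
    using N that by (force simp: image_iff)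
  then show "\<exists>N. \<forall>i j. A i j \<noteq> 0 \<longrightarrow> i < N \<and> j < N" by blast
next
  assume "\<exists>N. \<forall>i j. A i j \<noteq> 0 \<longrightarrow> i < N \<and> j < N"
  then obtain N where "\<forall>i j. A i j \<noteq> 0 \<longrightarrow> i < N \<and> j < N" by blast
  then have "{(i, j). A i j \<noteq> 0} \<subseteq> {..<N} \<times> {..<N}" by auto
  then show "finite {(i, j). A i j \<noteq> 0}"
    by (rule finite_subset) simp
qed

lemma entry_bound: "\<exists>N. \<forall>i j. entry A i j \<noteq> 0 \<longrightarrow> i < N \<and> j < N"
  using finite_entry[of A] by (simp only: finitary_bound)

instantiation finitary_matrix :: (ring) ring
begin

lift_definition zero_finitary_matrix :: "'a finitary_matrix" is "\<lambda>_ _. 0"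
  by simp

lift_definition plus_finitary_matrix :: "'a finitary_matrix \<Rightarrow> 'a finitary_matrix \<Rightarrow> 'a finitary_matrix"
  is "\<lambda>A B i j. A i j + B i j"
  subgoal for A B
    by (rule finite_subset[of _ "{(i, j). A i j \<noteq> 0} \<union> {(i, j). B i j \<noteq> 0}"]) auto
  done

lift_definition uminus_finitary_matrix :: "'a finitary_matrix \<Rightarrow> 'a finitary_matrix"
  is "\<lambda>A i j. - A i j"
  by simp

lift_definition minus_finitary_matrix :: "'a finitary_matrix \<Rightarrow> 'a finitary_matrix \<Rightarrow> 'a finitary_matrix"
  is "\<lambda>A B i j. A i j - B i j"
  subgoal for A B
    by (rule finite_subset[of _ "{(i, j). A i j \<noteq> 0} \<union> {(i, j). B i j \<noteq> 0}"]) auto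
  done

lift_definition times_finitary_matrix :: "'a finitary_matrix \<Rightarrow> 'a finitary_matrix \<Rightarrow> 'a finitary_matrix"
  is "\<lambda>A B i j. Sum_any (\<lambda>k. A i k * B k j)"
proof -
  fix A B :: "nat \<Rightarrow> nat \<Rightarrow> 'a"
  assume "finite {(i, j). A i j \<noteq> 0}" and "finite {(i, j). B i j \<noteq> 0}"
  then obtain M N where M: "\<forall>i j. A i j \<noteq> 0 \<longrightarrow> i < M \<and> j < M"
    and N: "\<forall>i j. B i j \<noteq> 0 \<longrightarrow> i < N \<and> j < N"
    unfolding finitary_bound by blast
  have "i < max M N \<and> j < max M N" if "Sum_any (\<lambda>k. A i k * B k j) \<noteq> 0" for i j
  proof -
    from that obtain k where "A i k * B k j \<noteq> 0"
      by (rule Sum_any.not_neutral_obtains_not_neutral)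
    then have "A i k \<noteq> 0" "B k j \<noteq> 0" by auto
    with M N show ?thesis by (auto simp: less_max_iff_disj)
  qed
  then show "finite {(i, j). Sum_any (\<lambda>k. A i k * B k j) \<noteq> 0}"
    unfolding finitary_bound by blast
qed

lemma entry_times_bounded:
  assumes "(\<forall>i j. entry A i j \<noteq> 0 \<longrightarrow> j < N) \<or> (\<forall>i j. entry B i j \<noteq> 0 \<longrightarrow> i < N)"
  shows "entry (A * B) i j = (\<Sum>k<N. entry A i k * entry B k j)"
  unfolding times_finitary_matrix.rep_eq
  by (rule Sum_any.expand_superset) (use assms in \<open>auto dest: mult_not_zero\<close>)

instance
proof
  fix A B C :: "'a finitary_matrix"
  show "A + B + C = A + (B + C)" by transfer (simp add: add.assoc)
  show "A + B = B + A" by transfer (simp add: add.commute)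
  show "0 + A = A" by transfer simp
  show "- A + A = 0" by transfer simp
  show "A - B = A + - B" by transfer simp
  obtain N where A: "\<forall>i j. entry A i j \<noteq> 0 \<longrightarrow> i < N \<and> j < N"
    using entry_bound by blast
  obtain M where C: "\<forall>i j. entry C i j \<noteq> 0 \<longrightarrow> i < M \<and> j < M"
    using entry_bound by blast
  have AD: "entry (A * D) i j = (\<Sum>k<N. entry A i k * entry D k j)" for D i j
    by (rule entry_times_bounded) (use A in blast)
  have DC: "entry (D * C) i j = (\<Sum>k<M. entry D i k * entry C k j)" for D i j
    by (rule entry_times_bounded) (use C in blast)
  show "A * B * C = A * (B * C)"
  proof (rule finitary_matrix_eqI)
    fix i j
    have "entry (A * B * C) i j = (\<Sum>k<M. \<Sum>l<N. entry A i l * entry B l k * entry C k j)"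
      by (simp add: DC AD sum_distrib_right)
    also have "\<dots> = (\<Sum>l<N. \<Sum>k<M. entry A i l * entry B l k * entry C k j)"
      by (rule sum.swap)
    also have "\<dots> = entry (A * (B * C)) i j"
      by (simp add: DC AD sum_distrib_left mult.assoc)
    finally show "entry (A * B * C) i j = entry (A * (B * C)) i j" .
  qed
  show "A * (B + C) = A * B + A * C"
    by (rule finitary_matrix_eqI)
       (simp add: AD plus_finitary_matrix.rep_eq distrib_left sum.distrib)
  show "(A + B) * C = A * C + B * C"
    by (rule finitary_matrix_eqI)
       (simp add: DC plus_finitary_matrix.rep_eq distrib_right sum.distrib)
qed

end

lift_definition scale_matrix :: "'f::field \<Rightarrow> 'f finitary_matrix \<Rightarrow> 'f finitary_matrix"
  is "\<lambda>c A i j. c * A i j"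
  subgoal for c A
    by (rule finite_subset[of _ "{(i, j). A i j \<noteq> 0}"]) auto
  done

interpretation finitary_matrix: nonunital_algebra "scale_matrix :: 'f::field \<Rightarrow> _"
proof
  fix c d :: 'f and A B :: "'f finitary_matrix"
  show "scale_matrix c (A + B) = scale_matrix c A + scale_matrix c B"
    by transfer (simp add: distrib_left)
  show "scale_matrix (c + d) A = scale_matrix c A + scale_matrix d A"
    by transfer (simp add: distrib_right)
  show "scale_matrix c (scale_matrix d A) = scale_matrix (c * d) A"
    by transfer (simp add: mult.assoc)
  show "scale_matrix 1 A = A"
    by transfer simp
  obtain N where A: "\<forall>i j. entry A i j \<noteq> 0 \<longrightarrow> i < N \<and> j < N"
    using entry_bound by blast
  have cA: "\<forall>i j. entry (scale_matrix c A) i j \<noteq> 0 \<longrightarrow> j < N"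
    using A by (auto simp: scale_matrix.rep_eq)
  have 1: "entry (A * D) i j = (\<Sum>k<N. entry A i k * entry D k j)" for D i j
    by (rule entry_times_bounded) (use A in blast)
  have 2: "entry (scale_matrix c A * D) i j = (\<Sum>k<N. entry (scale_matrix c A) i k * entry D k j)"
    for D i j
    by (rule entry_times_bounded) (use cA in blast)
  show "scale_matrix c (A * B) = scale_matrix c A * B"
    by (rule finitary_matrix_eqI)
       (simp add: 1 2 scale_matrix.rep_eq sum_distrib_left mult.assoc)
  show "scale_matrix c (A * B) = A * scale_matrix c B"
    by (rule finitary_matrix_eqI)
       (simp add: 1 scale_matrix.rep_eq sum_distrib_left mult.left_commute)
qed

definition mat_trace :: "'f::comm_monoid_add finitary_matrix \<Rightarrow> 'f" where
  "mat_trace A = Sum_any (\<lambda>i. entry A i i)"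

definition sl_inf :: "'f::field finitary_matrix set" where
  "sl_inf = {A. mat_trace A = 0}"

end

(* A trace-zero matrix is conjugate to a matrix B with zero diagonal, so it suffices to find
   B in the image. Work with n x n arrays of blocks, indexed cyclically, with B in the first block,
   and let every argument shift the block index by one. Pick a permutation with nonzero coefficient and let X_d be
   its last variable. The other arguments are generic weighted cyclic shifts, scaled by c_i in the
   i-th coordinate. The value of f is then linear in the argument for X_d, and its (i, j) entries are
   the image of the corresponding (i, j) entries of that argument under a linear map which, up to a
   power of c_i, is a polynomial in t = c_j / c_i. At t = 0 only the words ending in X_d survive,
   and the map is diagonal with nonzero entries. So it is invertible for all but finitely many t. *)
theory Submission
  imports Defs "HOL-Computational_Algebra.Polynomial" "HOL-Library.Nat_Bijection"
begin

section \<open>Conjugation by square-zero perturbations of the identity\<close>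

text \<open>Conjugation by \<open>1 + u\<close>, whose inverse is \<open>1 - u\<close>, written without the unit.\<close>

lemma (in nonunital_algebra) poly_image_conj:
  assumes "u * u = 0" "b \<in> poly_image f"
  shows "b + u * b - b * u - u * b * u \<in> poly_image f"
proof -
  define \<phi> where "\<phi> b = b + u * b - b * u - u * b * u" for b
  have uu: "u * (u * x) = 0" for x
    using assms(1) by (simp flip: mult.assoc)
  \<comment> \<open>Multiplicativity rests on (1 - u)(1 + u) = 1. Together with additivity and
    compatibility with scalars it makes \<open>\<phi>\<close> an algebra endomorphism, which
    commutes with evaluation of \<open>f\<close>.\<close>
  have mult: "\<phi> (x * y) = \<phi> x * \<phi> y" for x y
    by (simp add: \<phi>_def algebra_simps uu assms(1))
  have word: "word_eval (\<lambda>i. \<phi> (a i)) w = \<phi> (word_eval a w)" for a w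
  proof (induction a w rule: word_eval.induct)
    case (1 a)
    then show ?case by (simp add: \<phi>_def)
  qed (simp_all add: mult)
  have add: "\<phi> (x + y) = \<phi> x + \<phi> y" for x y
    by (simp add: \<phi>_def algebra_simps)
  have sc: "\<phi> (scale k x) = scale k (\<phi> x)" for k x
    by (simp add: \<phi>_def scale_right_distrib scale_right_diff_distrib scale_mult_left scale_mult_right
        flip: scale_mult_right scale_mult_left)
  have sum: "\<phi> (sum g S) = (\<Sum>x\<in>S. \<phi> (g x))" for g and S :: "word set"
    by (induction S rule: infinite_finite_induct) (simp_all add: add, simp_all add: \<phi>_def)
  from assms(2) obtain a where a: "b = poly_eval a f"
    by (auto simp: poly_image_def)
  have "\<phi> b = poly_eval (\<lambda>i. \<phi> (a i)) f"
    by (simp add: a poly_eval_def sum sc word)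
  then show ?thesis
    by (auto simp: \<phi>_def poly_image_def)
qed

text \<open>Conjugating by 1 + u and then by 1 - u gives back \<open>b\<close>; the second
  conjugation is the same formula with \<open>- u\<close> in place of \<open>u\<close>.\<close>

lemma conj_square_zero_inverse:
  fixes u b :: "'a::ring"
  assumes "u * u = 0" "c = b + u * b - b * u - u * b * u"
  shows "b = c + (- u) * c - c * (- u) - (- u) * c * (- u)"
proof -
  have uu: "u * (u * x) = 0" for x
    using assms(1) by (simp flip: mult.assoc)
  show ?thesis
    by (simp add: assms algebra_simps uu)
qed

lemma (in nonunital_algebra) poly_image_conjD:
  assumes "u * u = 0" "b + u * b - b * u - u * b * u \<in> poly_image f"
  shows "b \<in> poly_image f"
  by (subst conj_square_zero_inverse[OF assms(1) refl], rule poly_image_conj) (use assms in simp_all)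

section \<open>Scalars outside finite exceptional sets\<close>

lemma infinite_avoid_roots:
  fixes p :: "'i \<Rightarrow> 'f::field poly"
  assumes "infinite (UNIV :: 'f set)" "finite I" "\<And>i. i \<in> I \<Longrightarrow> p i \<noteq> 0"
  obtains z where "\<And>i. i \<in> I \<Longrightarrow> poly (p i) z \<noteq> 0"
proof -
  have "finite (\<Union>i\<in>I. {z. poly (p i) z = 0})"
    using assms(2,3) by (auto intro: poly_roots_finite)
  then obtain z where "z \<notin> (\<Union>i\<in>I. {z. poly (p i) z = 0})"
    using assms(1) ex_new_if_finite by blast
  then show ?thesis
    using that by blast
qed

text \<open>The determinant of \<open>m\<close> is a polynomial in t that is nonzero at 0, so it has
  finitely many roots. The proof uses Gaussian elimination instead; the exceptional set gathers the
  roots of the successive pivots and is independent of \<open>v\<close>.\<close>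

lemma poly_linear_system_solvable:
  fixes m :: "nat \<Rightarrow> nat \<Rightarrow> 'f::field poly"
  assumes "\<And>r. r < n \<Longrightarrow> poly (m r r) 0 \<noteq> 0"
    and "\<And>r g. r < n \<Longrightarrow> g < n \<Longrightarrow> r \<noteq> g \<Longrightarrow> poly (m r g) 0 = 0"
  shows "\<exists>T. finite T \<and> (\<forall>t v. t \<notin> T \<longrightarrow> (\<exists>x. \<forall>r<n. (\<Sum>g<n. poly (m r g) t * x g) = v r))"
  using assms
proof (induction n arbitrary: m)
  case 0
  then show ?case by auto
next
  case (Suc n)
  \<comment> \<open>Division-free elimination of unknown \<open>n\<close> with pivot
    \<open>m n n\<close>. For r < n the entries \<open>m r n\<close> vanish at 0, so
    \<open>m'\<close> is again diagonal there with nonzero diagonal.\<close>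
  define m' where "m' r g = m r g * m n n - m r n * m n g" for r g
  have "\<exists>T. finite T \<and> (\<forall>t v. t \<notin> T \<longrightarrow> (\<exists>x. \<forall>r<n. (\<Sum>g<n. poly (m' r g) t * x g) = v r))"
    by (rule Suc.IH) (simp_all add: m'_def Suc.prems)
  then obtain T where T: "finite T"
    "\<And>t v. t \<notin> T \<Longrightarrow> \<exists>x. \<forall>r<n. (\<Sum>g<n. poly (m' r g) t * x g) = v r"
    by blast
  have "m n n \<noteq> 0"
    using Suc.prems(1)[of n] by auto
  then have fin: "finite (T \<union> {t. poly (m n n) t = 0})"
    using T(1) poly_roots_finite by blast
  have "\<exists>x. \<forall>r<Suc n. (\<Sum>g<Suc n. poly (m r g) t * x g) = v r"
    if t: "t \<notin> T \<union> {t. poly (m n n) t = 0}" for t v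
  proof -
    have nz: "poly (m n n) t \<noteq> 0" using t by simp
    obtain x where x: "\<And>r. r < n \<Longrightarrow>
        (\<Sum>g<n. poly (m' r g) t * x g) = v r * poly (m n n) t - poly (m r n) t * v n"
      using T(2)[of t "\<lambda>r. v r * poly (m n n) t - poly (m r n) t * v n"] t by auto
    \<comment> \<open>Back substitution: \<open>y\<close> solves row \<open>n\<close> for the last
      unknown.\<close>
    define y where "y = (v n - (\<Sum>g<n. poly (m n g) t * x g)) / poly (m n n) t"
    have y: "poly (m n n) t * y = v n - (\<Sum>g<n. poly (m n g) t * x g)"
      using nz by (simp add: y_def)
    have "(\<Sum>g<n. poly (m r g) t * x g) + poly (m r n) t * y = v r" if "r < Suc n" for r
    proof (cases "r = n")
      case True
      then show ?thesis using y by simp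
    next
      case False
      then have "r < n" using that by simp
      have "((\<Sum>g<n. poly (m r g) t * x g) + poly (m r n) t * y) * poly (m n n) t
          = (\<Sum>g<n. poly (m r g) t * x g) * poly (m n n) t + poly (m r n) t * (poly (m n n) t * y)"
        by (simp add: algebra_simps)
      also have "\<dots> = (\<Sum>g<n. poly (m' r g) t * x g) + poly (m r n) t * v n"
        unfolding y by (simp add: m'_def algebra_simps sum_distrib_left sum_distrib_right sum_subtractf)
      also have "\<dots> = v r * poly (m n n) t"
        using x[OF \<open>r < n\<close>] by simp
      finally show ?thesis using nz by simp
    qed
    then show ?thesis
      by (intro exI[of _ "x(n := y)"]) simp
  qed
  with fin show ?case by blast
qed

text \<open>The values are chosen one at a time, and each new one has only finitely many forbidden
  values.\<close>

lemma exists_quotients_avoiding: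
  fixes T :: "'f::field set"
  assumes "infinite (UNIV :: 'f set)" "finite T"
  shows "\<exists>c :: nat \<Rightarrow> 'f. (\<forall>i<K. c i \<noteq> 0) \<and> (\<forall>i<K. \<forall>j<K. i \<noteq> j \<longrightarrow> c j / c i \<notin> T)"
proof (induction K)
  case (Suc K)
  then obtain c :: "nat \<Rightarrow> 'f" where c: "\<And>i. i < K \<Longrightarrow> c i \<noteq> 0"
    "\<And>i j. i < K \<Longrightarrow> j < K \<Longrightarrow> i \<noteq> j \<Longrightarrow> c j / c i \<notin> T"
    by blast
  \<comment> \<open>The two unions keep \<open>z / c i\<close> and \<open>c i / z\<close> out of
    \<open>T\<close>.\<close>
  let ?S = "insert 0 ((\<Union>i<K. (\<lambda>t. t * c i) ` T) \<union> (\<Union>i<K. (\<lambda>t. c i / t) ` T))"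
  have "finite ?S" using assms(2) by simp
  from ex_new_if_finite[OF assms(1) this] obtain z where z: "z \<notin> ?S" ..
  then have z0: "z \<noteq> 0" by simp
  have 1: "z / c i \<notin> T" if "i < K" for i
  proof
    assume "z / c i \<in> T"
    moreover have "z = z / c i * c i" using c(1)[OF that] by simp
    ultimately show False using z that by blast
  qed
  have 2: "c i / z \<notin> T" if "i < K" for i
  proof
    assume "c i / z \<in> T"
    moreover have "z = c i / (c i / z)" using c(1)[OF that] z0 by simp
    ultimately show False using z that by blast
  qed
  show ?case
    by (rule exI[of _ "c(K := z)"]) (use z0 c 1 2 in \<open>auto simp: less_Suc_eq\<close>)
qed auto

section \<open>Block shift matrices and the values of words on them\<close>

lemma entry_sum: "entry (sum g S) i j = (\<Sum>x\<in>S. entry (g x) i j)"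
  by (induction S rule: infinite_finite_induct)
     (simp_all add: zero_finitary_matrix.rep_eq plus_finitary_matrix.rep_eq)

text \<open>Index \<open>x = i + K * r\<close> with \<open>i < K\<close>, \<open>r < n\<close> stands for coordinate \<open>i\<close> at cyclic position \<open>r\<close>;
  the entry from \<open>(i, r)\<close> to \<open>(j, r + l mod n)\<close> is \<open>h r i j\<close>.\<close>

lift_definition block_shift :: "nat \<Rightarrow> nat \<Rightarrow> nat \<Rightarrow> (nat \<Rightarrow> nat \<Rightarrow> nat \<Rightarrow> 'f::zero) \<Rightarrow> 'f finitary_matrix"
  is "\<lambda>n K l h x y. if x < K * n \<and> y < K * n \<and> y div K = (x div K + l) mod n
        then h (x div K) (x mod K) (y mod K) else 0"
  subgoal for n K l h
    by (rule finite_subset[of _ "{..<K * n} \<times> {..<K * n}"]) auto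
  done

text \<open>In a product of block shifts only the columns of one block contribute; this turns the
  sum over matrix indices into one over coordinates.\<close>

lemma sum_block:
  fixes g :: "nat \<Rightarrow> 'a::comm_monoid_add"
  assumes "r < n"
  shows "(\<Sum>k<K * n. if k div K = r then g (k mod K) else 0) = (\<Sum>m<K. g m)"
proof (cases "K = 0")
  case False
  have "(\<Sum>k<K * n. if k div K = r then g (k mod K) else 0)
      = (\<Sum>k\<in>{k. k < K * n \<and> k div K = r}. g (k mod K))"
    by (rule sum.mono_neutral_cong_right) auto
  also have "\<dots> = (\<Sum>m<K. g m)"
  proof (rule sum.reindex_bij_witness[where i = "\<lambda>m. m + K * r" and j = "\<lambda>k. k mod K"])
    fix m assume "m \<in> {..<K}"
    then have "m + K * r < K * Suc r" by simp
    also have "\<dots> \<le> K * n" using assms by (intro mult_le_mono2) simp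
    finally show "m + K * r \<in> {k. k < K * n \<and> k div K = r}"
      using \<open>m \<in> {..<K}\<close> by simp
  qed (use False in auto)
  finally show ?thesis .
qed simp

text \<open>The first factor leads from position r to position r + l, so the second factor is read
  there. The total shift stays unreduced because \<open>block_shift\<close> itself reduces modulo
  n.\<close>

lemma block_shift_mult:
  fixes h h' :: "nat \<Rightarrow> nat \<Rightarrow> nat \<Rightarrow> 'f::ring"
  assumes "n > 0"
  shows "block_shift n K l h * block_shift n K l' h'
    = block_shift n K (l + l') (\<lambda>r i j. \<Sum>m<K. h r i m * h' ((r + l) mod n) m j)"
proof (rule finitary_matrix_eqI)
  fix x y
  let ?s = "(x div K + l) mod n"
  have "entry (block_shift n K l h * block_shift n K l' h') x y
      = (\<Sum>k<K * n. entry (block_shift n K l h) x k * entry (block_shift n K l' h') k y)"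
    by (rule entry_times_bounded) (auto simp: block_shift.rep_eq)
  also have "\<dots> = (\<Sum>k<K * n. if k div K = ?s then
      (if x < K * n \<and> y < K * n \<and> y div K = (?s + l') mod n
       then h (x div K) (x mod K) (k mod K) * h' ?s (k mod K) (y mod K) else 0) else 0)"
    by (rule sum.cong) (auto simp: block_shift.rep_eq)
  also have "\<dots> = (\<Sum>m<K. if x < K * n \<and> y < K * n \<and> y div K = (?s + l') mod n
       then h (x div K) (x mod K) m * h' ?s m (y mod K) else 0)"
    using assms by (intro sum_block) simp
  also have "\<dots> = entry (block_shift n K (l + l')
      (\<lambda>r i j. \<Sum>m<K. h r i m * h' ((r + l) mod n) m j)) x y"
    by (auto simp: block_shift.rep_eq mod_add_left_eq add.assoc)
  finally show "entry (block_shift n K l h * block_shift n K l' h') x y = \<dots>" .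
qed

lemma block_shift_cong:
  assumes "\<And>r i j. r < n \<Longrightarrow> i < K \<Longrightarrow> j < K \<Longrightarrow> h r i j = h' r i j"
  shows "block_shift n K l h = block_shift n K l h'"
proof (rule finitary_matrix_eqI)
  fix x y
  show "entry (block_shift n K l h) x y = entry (block_shift n K l h') x y"
  proof (cases "x < K * n")
    case True
    then have "K > 0" by (cases K) auto
    moreover have "x div K < n"
      using True by (simp add: less_mult_imp_div_less mult.commute)
    ultimately show ?thesis
      using assms by (simp add: block_shift.rep_eq)
  qed (simp add: block_shift.rep_eq)
qed

text \<open>Each letter advances the position by one, so letter p acts at position r + p, while
  coordinate i is kept and collects one factor \<open>c i\<close> per letter.\<close>

lemma word_eval_diagonal_shift:
  fixes c :: "nat \<Rightarrow> 'f::field"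
  assumes "n > 0" "w \<noteq> []"
    and "\<And>k. k \<in> set w \<Longrightarrow> a k = block_shift n K 1 (\<lambda>r i j. if i = j then c i * s k r else 0)"
  shows "word_eval a w = block_shift n K (length w)
    (\<lambda>r i j. if i = j then c i ^ length w * (\<Prod>p<length w. s (w ! p) ((r + p) mod n)) else 0)"
  using assms(2,3)
proof (induction a w rule: word_eval.induct)
  case (2 a k)
  have "a k = block_shift n K 1 (\<lambda>r i j. if i = j then c i * s k r else 0)"
    by (rule 2) simp
  also have "\<dots> = block_shift n K (length [k]) (\<lambda>r i j. if i = j then c i ^ length [k] *
      (\<Prod>p<length [k]. s ([k] ! p) ((r + p) mod n)) else 0)"
    unfolding list.size One_nat_def[symmetric] by (simp, rule block_shift_cong) simp
  finally show ?case by simp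
next
  case (3 a k k' w)
  let ?w = "k' # w"
  have "word_eval a (k # ?w) = a k * word_eval a ?w" by simp
  also have "\<dots> = block_shift n K 1 (\<lambda>r i j. if i = j then c i * s k r else 0) *
     block_shift n K (length ?w)
      (\<lambda>r i j. if i = j then c i ^ length ?w * (\<Prod>p<length ?w. s (?w ! p) ((r + p) mod n)) else 0)"
    using "3.prems"(2)[of k] "3.IH" "3.prems"(2)
    by (simp only: list.set_intros list.distinct simp_thms not_False_eq_True)
  also have "\<dots> = block_shift n K (length (k # ?w)) (\<lambda>r i j. if i = j then c i ^ length (k # ?w) *
      (\<Prod>p<length (k # ?w). s ((k # ?w) ! p) ((r + p) mod n)) else 0)"
    unfolding block_shift_mult[OF assms(1)] length_Cons[of k] plus_1_eq_Suc
    by (intro block_shift_cong)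
       (simp add: prod.lessThan_Suc_shift mod_add_left_eq if_distrib[of "\<lambda>x. x * _"] sum.delta
             del: prod.lessThan_Suc cong: if_cong)
  finally show ?case .
qed simp

text \<open>The q letters before \<open>d\<close> act in coordinate i and those after it in
  coordinate j, whence the two powers. \<open>\<gamma>\<close> is indexed by the position that
  \<open>d\<close> reaches, one more than r + q. By \<open>sd\<close> the product of weights may run
  over all letters, including \<open>d\<close>.\<close>

lemma word_eval_one_full_shift:
  fixes c :: "nat \<Rightarrow> 'f::field"
  assumes "n > 0" "q < length w" "w ! q = d" "\<And>p. p < length w \<Longrightarrow> p \<noteq> q \<Longrightarrow> w ! p \<noteq> d"
    and d: "a d = block_shift n K 1 (\<lambda>r i j. \<gamma> i j (Suc r mod n))"
    and k: "\<And>k. k \<noteq> d \<Longrightarrow> a k = block_shift n K 1 (\<lambda>r i j. if i = j then c i * s k r else 0)"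
    and sd: "\<And>r. s d r = 1"
  shows "word_eval a w = block_shift n K (length w)
    (\<lambda>r i j. c i ^ q * c j ^ (length w - 1 - q) * (\<Prod>p<length w. s (w ! p) ((r + p) mod n))
       * \<gamma> i j (Suc (r + q) mod n))"
  using assms(2-4)
proof (induction w arbitrary: q)
  case (Cons l w)
  show ?case
  proof (cases q)
    case 0
    have l: "l = d" using Cons.prems(2) 0 by simp
    have w: "k \<noteq> d" if "k \<in> set w" for k
    proof -
      from that obtain p where "p < length w" "w ! p = k" by (auto simp: in_set_conv_nth)
      then show ?thesis using Cons.prems(3)[of "Suc p"] 0 by simp
    qed
    show ?thesis
    proof (cases "w = []")
      case True
      then show ?thesis by (simp add: l 0 d sd)
    next
      case False
      have "word_eval a (l # w) = a d * word_eval a w"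
        using False l by (cases w) auto
      also have "\<dots> = block_shift n K 1 (\<lambda>r i j. \<gamma> i j (Suc r mod n)) * block_shift n K (length w)
        (\<lambda>r i j. if i = j then c i ^ length w * (\<Prod>p<length w. s (w ! p) ((r + p) mod n)) else 0)"
        using word_eval_diagonal_shift[OF assms(1) False, of a K c s] w k d by simp
      also have "\<dots> = block_shift n K (length (l # w))
        (\<lambda>r i j. c i ^ q * c j ^ (length (l # w) - 1 - q) *
          (\<Prod>p<length (l # w). s ((l # w) ! p) ((r + p) mod n)) * \<gamma> i j (Suc (r + q) mod n))"
        unfolding block_shift_mult[OF assms(1)] length_Cons plus_1_eq_Suc
        by (intro block_shift_cong)
          (simp add: 0 l sd prod.lessThan_Suc_shift mod_simps if_distrib[of "\<lambda>x. _ * x"] sum.delta'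
             del: prod.lessThan_Suc cong: if_cong)
      finally show ?thesis .
    qed
  next
    case (Suc q')
    have l: "l \<noteq> d" using Cons.prems(3)[of 0] Suc by simp
    have m: "Suc (Suc r mod n + q') mod n = Suc (Suc (r + q')) mod n" for r
      using mod_add_left_eq[of "Suc r" n "Suc q'"] by simp
    have ne: "w \<noteq> []" using Cons.prems(1) Suc by auto
    have q': "q' < length w" using Cons.prems(1) Suc by simp
    have "w ! q' = d" using Cons.prems(2) Suc by simp
    moreover have "w ! p \<noteq> d" if "p < length w" "p \<noteq> q'" for p
      using Cons.prems(3)[of "Suc p"] Suc that by simp
    ultimately have IH: "word_eval a w = block_shift n K (length w)
        (\<lambda>r i j. c i ^ q' * c j ^ (length w - 1 - q') * (\<Prod>p<length w. s (w ! p) ((r + p) mod n))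
          * \<gamma> i j (Suc (r + q') mod n))"
      using Cons.IH q' by blast
    have "word_eval a (l # w) = a l * word_eval a w"
      using ne by (cases w) auto
    also have "\<dots> = block_shift n K 1 (\<lambda>r i j. if i = j then c i * s l r else 0) *
        block_shift n K (length w)
        (\<lambda>r i j. c i ^ q' * c j ^ (length w - 1 - q') * (\<Prod>p<length w. s (w ! p) ((r + p) mod n))
          * \<gamma> i j (Suc (r + q') mod n))"
      by (simp only: IH k[OF l])
    also have "\<dots> = block_shift n K (length (l # w))
        (\<lambda>r i j. c i ^ q * c j ^ (length (l # w) - 1 - q) *
          (\<Prod>p<length (l # w). s ((l # w) ! p) ((r + p) mod n)) * \<gamma> i j (Suc (r + q) mod n))"
        unfolding block_shift_mult[OF assms(1)] length_Cons plus_1_eq_Suc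
        by (intro block_shift_cong)
          (simp add: Suc m prod.lessThan_Suc_shift mod_simps if_distrib[of "\<lambda>x. x * _"] sum.delta
             del: prod.lessThan_Suc cong: if_cong)
    finally show ?thesis .
  qed
qed simp

section \<open>Weights that separate permutations\<close>

lemma mod_add_inj:
  fixes r p p' n :: nat
  assumes "(r + p) mod n = (r + p') mod n" "p < n" "p' < n"
  shows "p = p'"
  using assms
proof (induction p p' rule: linorder_wlog)
  case (le p p')
  then have "n dvd (r + p') - (r + p)"
    by (subst mod_eq_dvd_iff_nat[symmetric]) auto
  then have "n dvd p' - p" by simp
  then show ?case using le by (auto dest: dvd_imp_le)
qed auto

text \<open>The weights are powers of one element \<open>z\<close> with distinct powers of two as exponents, so that
  distinct permutations contribute distinct monomials in \<open>z\<close>.\<close>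

lemma exists_generic_weights:
  fixes \<kappa> :: "(nat \<Rightarrow> nat) \<Rightarrow> 'f::field"
  assumes inf: "infinite (UNIV :: 'f set)" and "n \<ge> 1"
    and \<sigma>0: "\<sigma>0 permutes {1..n}" "\<kappa> \<sigma>0 \<noteq> 0"
  shows "\<exists>s. (\<forall>r. s (\<sigma>0 n) r = 1) \<and>
    (\<forall>r<n. (\<Sum>\<sigma> | \<sigma> permutes {1..n} \<and> \<sigma> n = \<sigma>0 n.
      \<kappa> \<sigma> * (\<Prod>p<n. s (\<sigma> (Suc p)) ((r + p) mod n))) \<noteq> 0)"
proof -
  define d where "d = \<sigma>0 n"
  define S where "S = {\<sigma>. \<sigma> permutes {1..n} \<and> \<sigma> n = d}"
  have fin: "finite S"
    unfolding S_def by (rule finite_subset[OF _ finite_permutations[of "{1..n}"]]) auto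
  \<comment> \<open>Letter and position are two digits in base \<open>Suc n\<close>: as letters lie
    in {1..n}, the letter is the remainder and the position the quotient.\<close>
  define code where "code r \<sigma> p = \<sigma> (Suc p) + Suc n * ((r + p) mod n)" for r p and \<sigma> :: "nat \<Rightarrow> nat"
  \<comment> \<open>\<open>set_encode\<close> sums the powers of two with exponents in the set, so
    its value determines the set. The last place p = n - 1 is left out: for \<open>\<sigma>\<close>
    in \<open>S\<close> it carries \<open>d\<close>, whose weight is 1.\<close>
  define e where "e r \<sigma> = set_encode (code r \<sigma> ` {..<n - 1})" for r and \<sigma> :: "nat \<Rightarrow> nat"
  define s where "s z k r = (if k = d then 1 else z ^ (2 ^ (k + Suc n * r)))" for z :: 'f and k r :: nat
  have code_eqD: "p = p' \<and> \<sigma> (Suc p) = \<tau> (Suc p')"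
    if "code r \<sigma> p = code r \<tau> p'" "\<sigma> \<in> S" "\<tau> \<in> S" "p < n" "p' < n" for r \<sigma> \<tau> p p'
  proof -
    have "\<sigma> (Suc p) \<in> {1..n}" "\<tau> (Suc p') \<in> {1..n}"
      using that permutes_in_image[of \<sigma> "{1..n}"] permutes_in_image[of \<tau> "{1..n}"] by (auto simp: S_def)
    then have *: "\<sigma> (Suc p) < Suc n" "\<tau> (Suc p') < Suc n" by auto
    have "code r \<sigma> p mod Suc n = \<sigma> (Suc p)" "code r \<tau> p' mod Suc n = \<tau> (Suc p')"
      "code r \<sigma> p div Suc n = (r + p) mod n" "code r \<tau> p' div Suc n = (r + p') mod n"
      unfolding code_def using * by (simp_all only: mod_mult_self2 mod_less div_mult_self2 div_less)
    then have "\<sigma> (Suc p) = \<tau> (Suc p')" "(r + p) mod n = (r + p') mod n"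
      using that(1) by simp_all
    with mod_add_inj that(4,5) show ?thesis by blast
  qed
  have inj: "inj_on (e r) S" for r
  proof (rule inj_onI)
    fix \<sigma> \<tau> assume st: "\<sigma> \<in> S" "\<tau> \<in> S" "e r \<sigma> = e r \<tau>"
    then have img: "code r \<sigma> ` {..<n - 1} = code r \<tau> ` {..<n - 1}"
      by (simp add: e_def set_encode_eq)
    show "\<sigma> = \<tau>"
    proof
      fix k
      consider "k \<notin> {1..n}" | "k = n" | p where "k = Suc p" "p < n - 1"
        by (cases k) force+
      then show "\<sigma> k = \<tau> k"
      proof cases
        case 1
        then show ?thesis using st(1,2) by (auto simp: S_def permutes_not_in[of _ "{1..n}" k])
      next
        case 2
        then show ?thesis using st by (simp add: S_def)
      next
        case 3
        then obtain p' where "p' < n - 1" "code r \<sigma> p = code r \<tau> p'"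
          using img by (metis (no_types, lifting) image_iff lessThan_iff)
        moreover from this 3 have "p < n" "p' < n" by simp_all
        ultimately show ?thesis using code_eqD[of r \<sigma> p \<tau> p'] st(1,2) 3 by blast
      qed
    qed
  qed
  have prod_s: "(\<Prod>p<n. s z (\<sigma> (Suc p)) ((r + p) mod n)) = z ^ e r \<sigma>" if "\<sigma> \<in> S" for z r \<sigma>
  proof -
    obtain n' where n': "n = Suc n'" using \<open>n \<ge> 1\<close> by (cases n) auto
    have "\<sigma> (Suc p) \<noteq> d" if "p < n'" for p
    proof
      assume "\<sigma> (Suc p) = d"
      then have "\<sigma> (Suc p) = \<sigma> n" using \<open>\<sigma> \<in> S\<close> by (simp add: S_def)
      then have "Suc p = n" using \<open>\<sigma> \<in> S\<close> by (auto simp: S_def dest: permutes_inj injD)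
      then show False using \<open>p < n'\<close> n' by simp
    qed
    then have "(\<Prod>p<n'. s z (\<sigma> (Suc p)) ((r + p) mod n)) = (\<Prod>p<n'. z ^ (2 ^ code r \<sigma> p))"
      by (intro prod.cong) (auto simp: s_def code_def)
    also have "\<dots> = z ^ (\<Sum>p<n'. 2 ^ code r \<sigma> p)"
      by (simp add: power_sum)
    also have "(\<Sum>p<n'. 2 ^ code r \<sigma> p) = e r \<sigma>"
    proof -
      have "inj_on (code r \<sigma>) {..<n'}"
        by (rule inj_onI) (use code_eqD[of r \<sigma> _ \<sigma>] that n' in auto)
      then show ?thesis by (simp add: e_def set_encode_def sum.reindex n')
    qed
    finally show ?thesis
      using that by (simp add: n' s_def S_def)
  qed
  have \<sigma>0S: "\<sigma>0 \<in> S" using \<sigma>0 by (simp add: S_def d_def)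
  \<comment> \<open>By injectivity of \<open>e r\<close>, the coefficient at
    \<open>e r \<sigma>0\<close> is \<open>\<kappa> \<sigma>0\<close>. A single z must avoid the
    roots of all \<open>P r\<close> with r < n.\<close>
  define P where "P r = (\<Sum>\<sigma>\<in>S. monom (\<kappa> \<sigma>) (e r \<sigma>))" for r
  have "P r \<noteq> 0" for r
  proof -
    have "coeff (P r) (e r \<sigma>0) = (\<Sum>\<sigma>\<in>S. if \<sigma> = \<sigma>0 then \<kappa> \<sigma>0 else 0)"
      unfolding P_def coeff_sum coeff_monom using inj_onD[OF inj] \<sigma>0S by (intro sum.cong) auto
    also have "\<dots> = \<kappa> \<sigma>0" using fin \<sigma>0S by simp
    finally show ?thesis using \<sigma>0(2) by auto
  qed
  then obtain z where z: "\<And>r. r \<in> {..<n} \<Longrightarrow> poly (P r) z \<noteq> 0"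
    using infinite_avoid_roots[OF inf, of "{..<n}" P] by blast
  have "(\<Sum>\<sigma>\<in>S. \<kappa> \<sigma> * (\<Prod>p<n. s z (\<sigma> (Suc p)) ((r + p) mod n))) = poly (P r) z" for r
    by (simp add: P_def poly_sum poly_monom prod_s)
  then show ?thesis
    using z by (intro exI[of _ "s z"]) (simp add: S_def s_def flip: d_def)
qed

section \<open>Matrices with zero diagonal as values of the polynomial\<close>

text \<open>Solving for entry (i, j) needs \<open>c j / c i\<close> outside a finite set. For i = j
  this quotient is always 1, which may be exceptional; the zero diagonal makes that case
  trivial.\<close>

lemma zero_diagonal_in_poly_image:
  fixes f :: "'f::field nc_poly"
  assumes inf: "infinite (UNIV :: 'f set)" and "n \<ge> 1" and "multilinear n f" and "f \<noteq> 0"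
    and diag: "\<And>i. entry B i i = 0"
  shows "B \<in> finitary_matrix.poly_image f"
proof -
  let ?P = "{\<sigma>. \<sigma> permutes {1..n}}"
  let ?w = "\<lambda>\<sigma>. map \<sigma> [1..<Suc n]"
  have finP: "finite ?P" by (simp add: finite_permutations)
  obtain \<kappa> where f: "f = (\<Sum>\<sigma>\<in>?P. Poly_Mapping.single (Word (?w \<sigma>)) (\<kappa> \<sigma>))"
    using assms(3) unfolding multilinear_altdef by blast
  then obtain \<sigma>0 where \<sigma>0: "\<sigma>0 permutes {1..n}" "\<kappa> \<sigma>0 \<noteq> 0"
    using \<open>f \<noteq> 0\<close> by (metis (no_types, lifting) mem_Collect_eq single_zero sum.neutral)
  define d where "d = \<sigma>0 n"
  have d: "d \<in> {1..n}"
    using \<sigma>0(1) \<open>n \<ge> 1\<close> permutes_in_image[of \<sigma>0 "{1..n}" n] by (simp add: d_def)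
  obtain s where sd: "\<And>r. s d r = 1" and s: "\<And>r. r < n \<Longrightarrow>
      (\<Sum>\<sigma> | \<sigma> permutes {1..n} \<and> \<sigma> n = d. \<kappa> \<sigma> * (\<Prod>p<n. s (\<sigma> (Suc p)) ((r + p) mod n))) \<noteq> 0"
    using exists_generic_weights[where \<kappa> = \<kappa>, OF inf \<open>n \<ge> 1\<close> \<sigma>0] by (auto simp: d_def)
  \<comment> \<open>The zero-based place of \<open>d\<close> in the word of
    \<open>\<sigma>\<close>.\<close>
  define q where "q \<sigma> = inv \<sigma> d - 1" for \<sigma> :: "nat \<Rightarrow> nat"
  have q: "q \<sigma> < n" "\<sigma> (Suc (q \<sigma>)) = d" "\<sigma> (Suc p) = d \<Longrightarrow> p = q \<sigma>" if "\<sigma> permutes {1..n}" for \<sigma> p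
  proof -
    have "inv \<sigma> d \<in> {1..n}"
      using d permutes_in_image[OF permutes_inv[OF that]] by blast
    then have 1: "Suc (q \<sigma>) = inv \<sigma> d" "q \<sigma> < n" by (auto simp: q_def)
    show "q \<sigma> < n" by fact
    show "\<sigma> (Suc (q \<sigma>)) = d" using permutes_inverses(1)[OF that] by (simp add: 1)
    show "p = q \<sigma>" if "\<sigma> (Suc p) = d"
      using permutes_inverses(2)[OF \<open>\<sigma> permutes {1..n}\<close>, of "Suc p"] that 1 by simp
  qed
  have n: "Suc (n - 1) = n" using \<open>n \<ge> 1\<close> by simp
  have q_last: "q \<sigma> = n - 1 \<longleftrightarrow> \<sigma> n = d" if "\<sigma> permutes {1..n}" for \<sigma>
    using q(2)[OF that] q(3)[OF that, of "n - 1"] n by metis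
  define \<mu> where "\<mu> r \<sigma> = \<kappa> \<sigma> * (\<Prod>p<n. s (\<sigma> (Suc p)) ((r + p) mod n))" for r \<sigma>
  \<comment> \<open>Coefficient matrix of the linear system for \<open>\<gamma>\<close>: the entry
    at (r, g) collects the words that start at r and read \<open>\<gamma>\<close> at g. The exponent
    counts the letters after \<open>d\<close>, each of which turns a factor \<open>c i\<close> into
    \<open>c j\<close>.\<close>
  define m where "m r g = (\<Sum>\<sigma>\<in>{\<sigma>\<in>?P. Suc (r + q \<sigma>) mod n = g}. monom (\<mu> r \<sigma>) (n - 1 - q \<sigma>))" for r g
  \<comment> \<open>At 0 only words ending in \<open>d\<close> remain. They return to the starting
    position, so g = r, and the diagonal entry is the sum that the weights \<open>s\<close> make
    nonzero.\<close>
  have m0: "poly (m r g) 0 = (\<Sum>\<sigma>\<in>{\<sigma>\<in>?P. Suc (r + q \<sigma>) mod n = g \<and> q \<sigma> = n - 1}. \<mu> r \<sigma>)" for r g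
    unfolding m_def poly_sum poly_monom
    by (rule sum.mono_neutral_cong_right) (use finP q(1) in \<open>fastforce+\<close>)
  have "\<exists>T. finite T \<and> (\<forall>t v. t \<notin> T \<longrightarrow> (\<exists>x. \<forall>r<n. (\<Sum>g<n. poly (m r g) t * x g) = v r))"
  proof (rule poly_linear_system_solvable)
    fix r assume r: "r < n"
    have "{\<sigma>\<in>?P. Suc (r + q \<sigma>) mod n = r \<and> q \<sigma> = n - 1} = {\<sigma>. \<sigma> permutes {1..n} \<and> \<sigma> n = d}"
      (is "?L = ?R")
    proof (rule set_eqI)
      fix \<sigma>
      have "Suc (r + (n - 1)) mod n = r"
        using r n by (metis add_Suc_right mod_add_self2 mod_less)
      then show "\<sigma> \<in> ?L \<longleftrightarrow> \<sigma> \<in> ?R"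
        using q_last[of \<sigma>] by auto
    qed
    then show "poly (m r r) 0 \<noteq> 0"
      using s[OF r] by (simp add: m0 \<mu>_def)
  next
    fix r g assume "r < n" "g < n" "r \<noteq> g"
    moreover from this n have "Suc (r + (n - 1)) mod n = r"
      by (metis add_Suc_right mod_add_self2 mod_less)
    ultimately have "{\<sigma>\<in>?P. Suc (r + q \<sigma>) mod n = g \<and> q \<sigma> = n - 1} = {}"
      by force
    then show "poly (m r g) 0 = 0" by (simp only: m0 sum.empty)
  qed
  then obtain T where T: "finite T"
    "\<And>t v. t \<notin> T \<Longrightarrow> \<exists>x. \<forall>r<n. (\<Sum>g<n. poly (m r g) t * x g) = v r"
    by blast
  obtain K where K: "\<And>i j. entry B i j \<noteq> 0 \<Longrightarrow> i < K \<and> j < K"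
    using entry_bound[of B] by blast
  obtain c :: "nat \<Rightarrow> 'f" where c: "\<And>i. i < K \<Longrightarrow> c i \<noteq> 0"
    "\<And>i j. i < K \<Longrightarrow> j < K \<Longrightarrow> i \<noteq> j \<Longrightarrow> c j / c i \<notin> T"
    using exists_quotients_avoiding[OF inf T(1), of K] by blast
  \<comment> \<open>The right-hand side prescribes \<open>B\<close> in the block at position 0 and
    zero in the other blocks.\<close>
  have "\<exists>x. \<forall>r<n. c i ^ (n - 1) * (\<Sum>g<n. poly (m r g) (c j / c i) * x g) = (if r = 0 then entry B i j else 0)"
    if ij: "i < K" "j < K" for i j
  proof (cases "i = j")
    case True
    then show ?thesis by (intro exI[of _ "\<lambda>_. 0"]) (simp add: diag)
  next
    case False
    obtain x where "\<forall>r<n. (\<Sum>g<n. poly (m r g) (c j / c i) * x g)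
        = (if r = 0 then entry B i j / c i ^ (n - 1) else 0)"
      using T(2)[OF c(2)[OF ij False], of "\<lambda>r. if r = 0 then entry B i j / c i ^ (n - 1) else 0"] by blast
    then show ?thesis
      using c(1)[OF ij(1)] by (intro exI[of _ x]) auto
  qed
  then obtain \<gamma> where \<gamma>: "\<And>i j r. i < K \<Longrightarrow> j < K \<Longrightarrow> r < n \<Longrightarrow>
     c i ^ (n - 1) * (\<Sum>g<n. poly (m r g) (c j / c i) * \<gamma> i j g) = (if r = 0 then entry B i j else 0)"
    by metis
  define a where "a k = block_shift n K 1 (\<lambda>r i j. if k = d then \<gamma> i j (Suc r mod n)
      else if i = j then c i * s k r else 0)" for k
  have word: "word_eval a (?w \<sigma>) = block_shift n K n (\<lambda>r i j. c i ^ q \<sigma> * c j ^ (n - 1 - q \<sigma>) *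
      (\<Prod>p<n. s (\<sigma> (Suc p)) ((r + p) mod n)) * \<gamma> i j (Suc (r + q \<sigma>) mod n))"
    if "\<sigma> permutes {1..n}" for \<sigma>
  proof -
    have nth: "?w \<sigma> ! p = \<sigma> (Suc p)" if "p < n" for p
      using that by (simp del: upt_Suc)
    have len: "length (?w \<sigma>) = n" by (simp del: upt_Suc)
    have "word_eval a (?w \<sigma>) = block_shift n K (length (?w \<sigma>))
        (\<lambda>r i j. c i ^ q \<sigma> * c j ^ (length (?w \<sigma>) - 1 - q \<sigma>) *
          (\<Prod>p<length (?w \<sigma>). s (?w \<sigma> ! p) ((r + p) mod n)) * \<gamma> i j (Suc (r + q \<sigma>) mod n))"
    proof (rule word_eval_one_full_shift[where d = d])
      show "n > 0" using \<open>n \<ge> 1\<close> by simp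
      show "q \<sigma> < length (?w \<sigma>)" using q(1)[OF that] by (simp only: len)
      show "?w \<sigma> ! q \<sigma> = d" using nth[OF q(1)[OF that]] q(2)[OF that] by (simp only:)
      show "?w \<sigma> ! p \<noteq> d" if "p < length (?w \<sigma>)" "p \<noteq> q \<sigma>" for p
        using nth[of p] q(3)[OF \<open>\<sigma> permutes {1..n}\<close>, of p] that by (auto simp only: len)
    qed (simp_all add: a_def sd)
    also have "\<dots> = block_shift n K n (\<lambda>r i j. c i ^ q \<sigma> * c j ^ (n - 1 - q \<sigma>) *
      (\<Prod>p<n. s (\<sigma> (Suc p)) ((r + p) mod n)) * \<gamma> i j (Suc (r + q \<sigma>) mod n))"
      unfolding len by (intro block_shift_cong) (simp add: nth del: upt_Suc)
    finally show ?thesis .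
  qed
  have ev: "entry (finitary_matrix.poly_eval a f) x y
      = (\<Sum>\<sigma>\<in>?P. \<kappa> \<sigma> * entry (word_eval a (?w \<sigma>)) x y)" for x y
    by (simp add: f finitary_matrix.poly_eval_sum entry_sum scale_matrix.rep_eq del: upt_Suc)
  have "entry (finitary_matrix.poly_eval a f) x y = entry B x y" for x y
  \<comment> \<open>A word of length n shifts by n, which is 0 modulo n, so the value of
    \<open>f\<close> is block diagonal.\<close>
  proof (cases "x < K * n \<and> y < K * n \<and> y div K = x div K")
    case True
    define r i j where "r = x div K" and "i = x mod K" and "j = y mod K"
    have "K > 0" using True by (cases K) auto
    then have ij: "i < K" "j < K" by (simp_all add: i_def j_def)
    have r: "r < n"
      using True by (simp add: r_def less_mult_imp_div_less mult.commute)
    have "entry (finitary_matrix.poly_eval a f) x y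
        = (\<Sum>\<sigma>\<in>?P. \<mu> r \<sigma> * (c i ^ q \<sigma> * c j ^ (n - 1 - q \<sigma>)) * \<gamma> i j (Suc (r + q \<sigma>) mod n))"
      unfolding ev using True r
      by (intro sum.cong) (simp_all add: word block_shift.rep_eq \<mu>_def r_def i_def j_def mult_ac del: upt_Suc One_nat_def)
    also have "\<dots> = (\<Sum>\<sigma>\<in>?P. c i ^ (n - 1) *
        (\<mu> r \<sigma> * (c j / c i) ^ (n - 1 - q \<sigma>) * \<gamma> i j (Suc (r + q \<sigma>) mod n)))"
    proof (rule sum.cong)
      fix \<sigma> assume "\<sigma> \<in> ?P"
      then have "q \<sigma> \<le> n - 1" using q(1)[of \<sigma>] by simp
      then have "c i ^ (n - 1) = c i ^ q \<sigma> * c i ^ (n - 1 - q \<sigma>)"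
        by (simp only: power_add[symmetric] le_add_diff_inverse)
      then show "\<mu> r \<sigma> * (c i ^ q \<sigma> * c j ^ (n - 1 - q \<sigma>)) * \<gamma> i j (Suc (r + q \<sigma>) mod n) =
         c i ^ (n - 1) * (\<mu> r \<sigma> * (c j / c i) ^ (n - 1 - q \<sigma>) * \<gamma> i j (Suc (r + q \<sigma>) mod n))"
        using c(1)[OF ij(1)] by (simp add: power_divide)
    qed simp
    \<comment> \<open>Grouping the permutations by the position where \<open>\<gamma>\<close> is
      read exhibits the system that \<open>\<gamma>\<close> solves.\<close>
    also have "\<dots> = c i ^ (n - 1) * (\<Sum>g<n. \<Sum>\<sigma>\<in>{\<sigma>\<in>?P. Suc (r + q \<sigma>) mod n = g}.
        \<mu> r \<sigma> * (c j / c i) ^ (n - 1 - q \<sigma>) * \<gamma> i j (Suc (r + q \<sigma>) mod n))"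
      unfolding sum_distrib_left[symmetric]
      by (subst sum.group) (use finP \<open>n \<ge> 1\<close> in auto)
    also have "\<dots> = c i ^ (n - 1) * (\<Sum>g<n. poly (m r g) (c j / c i) * \<gamma> i j g)"
      by (simp add: m_def poly_sum poly_monom sum_distrib_right)
    also have "\<dots> = (if r = 0 then entry B i j else 0)"
      by (rule \<gamma>[OF ij r])
    also have "\<dots> = entry B x y"
    proof (cases "r = 0")
      case True
      \<comment> \<open>The block at position 0 occupies the indices below \<open>K\<close>, where
        index and coordinate coincide.\<close>
      then have "x < K" "y < K"
        using \<open>K > 0\<close> \<open>x < K * n \<and> y < K * n \<and> y div K = x div K\<close> by (simp_all add: r_def div_eq_0_iff)
      then show ?thesis using True by (simp add: i_def j_def)
    next
      case False
      then have "\<not> x < K" by (auto simp: r_def)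
      then show ?thesis using K[of x y] False by auto
    qed
    finally show ?thesis .
  next
    case False
    have "x div K < n" if "x < K * n"
      using that by (simp add: less_mult_imp_div_less mult.commute)
    then have "entry (finitary_matrix.poly_eval a f) x y = 0"
      unfolding ev using False
      by (intro sum.neutral) (auto simp: word block_shift.rep_eq simp del: upt_Suc One_nat_def)
    moreover have "entry B x y = 0"
    proof (rule ccontr)
      assume "entry B x y \<noteq> 0"
      then have "x < K" "y < K" using K by blast+
      moreover have "K \<le> K * n" using \<open>n \<ge> 1\<close> by simp
      ultimately have "x < K * n" "y < K * n" by linarith+
      then show False using False \<open>x < K\<close> \<open>y < K\<close> by simp
    qed
    ultimately show ?thesis by simp
  qed
  then have "B = finitary_matrix.poly_eval a f"
    by (intro finitary_matrix_eqI) simp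
  then show ?thesis
    by (auto simp: finitary_matrix.poly_image_def)
qed

section \<open>Clearing the diagonal by two conjugations\<close>

text \<open>The diagonal is cleared by adding column \<open>N\<close> and then row \<open>N\<close> outside the support of \<open>A\<close>:
  the first conjugation produces a column \<open>- v\<close>, where \<open>v = A x\<close> is nonzero wherever the diagonal
  of \<open>A\<close> is; the second adds \<open>v i * y i = - A i i\<close> to the diagonal and leaves the trace at
  position \<open>N\<close>.\<close>

lemma trace_zero_conj_zero_diagonal:
  fixes A :: "'f::field finitary_matrix"
  assumes inf: "infinite (UNIV :: 'f set)" and tr: "mat_trace A = 0"
  obtains u w A1 A2 where "u * u = 0" "w * w = 0" "A1 = A + u * A - A * u - u * A * u"
    "A2 = A1 + w * A1 - A1 * w - w * A1 * w" "\<And>i. entry A2 i i = 0"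
proof -
  obtain N where N: "\<And>i j. entry A i j \<noteq> 0 \<Longrightarrow> i < N \<and> j < N"
    using entry_bound[of A] by blast
  have tr': "(\<Sum>i<N. entry A i i) = 0"
    using tr unfolding mat_trace_def by (subst (asm) Sum_any.expand_superset[of "{..<N}"]) (auto dest: N)
  \<comment> \<open>The vector x has entries \<open>z ^ j\<close>, so the i-th entry of A x is
    \<open>p i\<close> at z; the coefficient of \<open>p i\<close> at i is the diagonal
    entry.\<close>
  define p where "p i = (\<Sum>j<N. monom (entry A i j) j)" for i
  have "p i \<noteq> 0" if "entry A i i \<noteq> 0" for i
  proof -
    have "coeff (p i) i = entry A i i"
      using N[OF that] by (simp add: p_def coeff_sum)
    then show ?thesis using that by auto
  qed
  then obtain z where z: "\<And>i. i \<in> {i. i < N \<and> entry A i i \<noteq> 0} \<Longrightarrow> poly (p i) z \<noteq> 0"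
    using infinite_avoid_roots[OF inf, of "{i. i < N \<and> entry A i i \<noteq> 0}" p] by fastforce
  define v where "v i = (\<Sum>j<N. entry A i j * z ^ j)" for i
  have v: "v i \<noteq> 0" if "entry A i i \<noteq> 0" for i
    using z[of i] N[OF that] that by (simp add: v_def p_def poly_sum poly_monom)
  have v0: "v i = 0" if "i \<ge> N" for i
    unfolding v_def using N[of i] that by (intro sum.neutral) auto
  \<comment> \<open>Where \<open>entry A i i\<close> is 0, \<open>v i\<close> may vanish as well,
    hence the separate value 0.\<close>
  define y where "y i = (if entry A i i = 0 then 0 else - entry A i i / v i)" for i
  have vy: "v i * y i = - entry A i i" for i
    using v[of i] by (simp add: y_def)
  \<comment> \<open>\<open>u\<close> carries x in column \<open>N\<close>, and \<open>w\<close>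
    below carries \<open>y\<close> in row \<open>N\<close>. Both have entry 0 at (N, N), so they
    square to zero.\<close>
  define u where "u = Finitary_Matrix (\<lambda>i j. if i < N \<and> j = N then z ^ i else 0)"
  have u: "entry u i j = (if i < N \<and> j = N then z ^ i else 0)" for i j
    unfolding u_def
    by (subst Finitary_Matrix_inverse) (auto simp: finitary_bound intro!: exI[of _ "Suc N"])
  define w where "w = Finitary_Matrix (\<lambda>i j. if i = N \<and> j < N then y j else 0)"
  have w: "entry w i j = (if i = N \<and> j < N then y j else 0)" for i j
    unfolding w_def
    by (subst Finitary_Matrix_inverse) (auto simp: finitary_bound intro!: exI[of _ "Suc N"])
  have entry_w: "entry (w * X) i j = (if i = N then \<Sum>k<N. y k * entry X k j else 0)" for X i j
    by (subst entry_times_bounded[where N = N]) (auto simp: w split: if_splits)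
  have entry_u: "entry (X * u) i j = (if j = N then \<Sum>k<N. entry X i k * z ^ k else 0)" for X i j
    by (subst entry_times_bounded[where N = N]) (auto simp: u split: if_splits)
  have entry_w': "entry (X * w) i j = (if j < N then entry X i N * y j else 0)" for X i j
    by (subst entry_times_bounded[where N = "Suc N"]) (auto simp: w split: if_splits)
  have entry_u': "entry (u * X) i j = (if i < N then z ^ i * entry X N j else 0)" for X i j
    by (subst entry_times_bounded[where N = "Suc N"]) (auto simp: u split: if_splits)
  note entries = plus_finitary_matrix.rep_eq minus_finitary_matrix.rep_eq zero_finitary_matrix.rep_eq
  have uu: "u * u = 0"
    by (rule finitary_matrix_eqI) (simp add: entry_u u entries)
  have ww: "w * w = 0"
    by (rule finitary_matrix_eqI) (simp add: entry_w w entries)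
  have AN: "entry A N j = 0" "entry A i N = 0" for i j
    using N[of N j] N[of i N] by auto
  define A1 where "A1 = A + u * A - A * u - u * A * u"
  \<comment> \<open>Row \<open>N\<close> of \<open>A\<close> is zero, so \<open>u * A\<close>
    vanishes and only \<open>- A * u\<close> changes \<open>A\<close>.\<close>
  have A1: "entry A1 i j = entry A i j - (if j = N then v i else 0)" for i j
    by (simp add: A1_def entries entry_u entry_u' AN v_def)
  define A2 where "A2 = A1 + w * A1 - A1 * w - w * A1 * w"
  have "entry A2 i i = 0" for i
  proof (cases i N rule: linorder_cases)
    case less
    then show ?thesis by (simp add: A2_def entries entry_w entry_w' A1 AN vy)
  next
    case equal
    \<comment> \<open>The entry of \<open>A2\<close> at (N, N) is minus this sum, which by
      \<open>vy\<close> is the trace of \<open>A\<close>.\<close>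
    have "(\<Sum>k<N. y k * v k) = 0"
      using tr' by (simp add: mult.commute[of "y _"] vy sum_negf)
    then show ?thesis using equal by (simp add: A2_def entries entry_w entry_w' A1 AN v0 sum_negf)
  next
    case greater
    then show ?thesis using N[of i i] by (auto simp: A2_def entries entry_w entry_w' A1)
  qed
  then show ?thesis
    using that uu ww A1_def A2_def by blast
qed

theorem corollary1p2:
  fixes n :: nat and f :: "'f::field nc_poly"
  assumes "infinite (UNIV :: 'f set)"
    and "n \<ge> 1"
    and "f \<in> free_algebra n"
    and "multilinear n f"
    and "f \<noteq> 0"
  shows "sl_inf \<subseteq> finitary_matrix.poly_image f"
proof
  fix A :: "'f finitary_matrix" assume "A \<in> sl_inf"
  then have "mat_trace A = 0" by (simp add: sl_inf_def)
  from trace_zero_conj_zero_diagonal[OF assms(1) this] obtain u w A1 A2 where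
    conj: "u * u = 0" "w * w = 0" "A1 = A + u * A - A * u - u * A * u"
      "A2 = A1 + w * A1 - A1 * w - w * A1 * w" and diag: "\<And>i. entry A2 i i = 0"
    by blast
  have "A2 \<in> finitary_matrix.poly_image f"
    using zero_diagonal_in_poly_image[OF assms(1,2,4,5) diag] .
  \<comment> \<open>The two conjugations are undone in reverse order.\<close>
  then have "A1 \<in> finitary_matrix.poly_image f"
    using finitary_matrix.poly_image_conjD conj(2,4) by blast
  then show "A \<in> finitary_matrix.poly_image f"
    using finitary_matrix.poly_image_conjD conj(1,3) by blast
qed

end
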